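(* Let $0<q<1$, and let $\zeta_q(s)$ be the meromorphic function on $\mathbf{C}$ obtained by continuation of $\sum_{n=1}^\infty q^{n(s-1)}/[n]_q^s$ $(\mathrm{Re}(s)>1)$. 1) The function $\zeta_q(s)$ has a simple pole at the points of $1+2\pi i\,\mathbf{Z}/\log q$ and at the points of the set $$\left\{a+\frac{2\pi i b}{\log q}\ \middle|\ a,b\in\mathbf{Z},\ a\le0,\ b\neq0\right\}.$$ In particular, $s=1$ is a simple pole of $\zeta_q(s)$ with residue $(q-1)/\log q$. 2) For every integer $m\ge0$, the limiting value $\lim_{s\to-m}\zeta_q(s)$ exists (and is written $\zeta_q(-m)$), and it is given explicitly by $$\zeta_q(-m)=(1-q)^{-m}\left\{\sum_{r=0}^m(-1)^r\binom{m}{r}\frac{1}{q^{m+1-r}-1}+\frac{(-1)^{m+1}}{(m+1)\log q}\right\}.$$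
   Context: For $0<q<1$ and an integer $n\ge1$, $[n]_q=(1-q^n)/(1-q)>0$. Powers of positive reals are $x^s=e^{s\log x}$ with real logarithm. The series $\sum_{n\ge1}q^{n(s-1)}/[n]_q^s$ converges absolutely for $\mathrm{Re}(s)>1$, and its meromorphic continuation to $s\in\mathbf{C}$ is given by $$\zeta_q(s)=(1-q)^s\sum_{r=0}^\infty\binom{s+r-1}{r}\frac{q^{s+r-1}}{1-q^{s+r-1}},\qquad \binom{s+r-1}{r}=\frac{s(s+1)\cdots(s+r-1)}{r!}.$$ *)

theory Defs
  imports "HOL-Complex_Analysis.Complex_Analysis"
begin

definition q_bracket :: "real \<Rightarrow> nat \<Rightarrow> real" where
  "q_bracket q n = (1 - q ^ n) / (1 - q)"

text \<open>
  For \<open>0 < q < 1\<close> and \<open>n \<ge> 1\<close> both bases below are positive reals, so complex \<open>powr\<close>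
  (principal logarithm) agrees with \<open>exp (s * ln x)\<close> for the real logarithm.
\<close>

definition q_zeta_term :: "real \<Rightarrow> complex \<Rightarrow> nat \<Rightarrow> complex" where
  "q_zeta_term q s n =
     complex_of_real q powr (of_nat n * (s - 1)) / complex_of_real (q_bracket q n) powr s"

text \<open>
  The meromorphic continuation to the whole plane of the series. The condition
  \<open>nicely_meromorphic_on\<close> fixes the values at singularities (limit at removable ones, \<open>0\<close> at
  poles); by the identity theorem at most one function satisfies the description.
\<close>

definition q_zeta :: "real \<Rightarrow> complex \<Rightarrow> complex" where
  "q_zeta q = (THE f. f nicely_meromorphic_on UNIV \<and>
                 (\<forall>s. Re s > 1 \<longrightarrow> (q_zeta_term q s has_sum f s) {1..}))"

definition q_zeta_poles :: "real \<Rightarrow> complex set" where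
  "q_zeta_poles q =
     {1 + 2 * of_real pi * \<i> * of_int b / of_real (ln q) | b :: int. True} \<union>
     {of_int a + 2 * of_real pi * \<i> * of_int b / of_real (ln q) | a b :: int. a \<le> 0 \<and> b \<noteq> 0}"

end

theory Submission
  imports Defs
begin

text \<open>
  Put \<open>L u = q\<^sup>u / (1 - q\<^sup>u)\<close>. Expanding \<open>(1 - q\<^sup>n) powr (-s)\<close> by the binomial series and summing
  over \<open>n\<close> first turns the series into \<open>(1 - q)\<^sup>s\<close> times the sum over \<open>r\<close> of
  \<open>pochhammer s r / r! * L (s + r - 1)\<close>. The terms with \<open>r \<ge> N\<close> sum to a holomorphic function on
  \<open>Re s > 1 - N\<close>, so the formula is meromorphic on the plane, and at a point with \<open>Re s = 1 - k\<close>
  only the term \<open>r = k\<close> can be singular. There \<open>L\<close> has a simple pole with residue \<open>-1 / ln q\<close>;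
  it survives unless its coefficient \<open>pochhammer s k\<close> vanishes, which happens exactly at
  \<open>s = 1 - k\<close> with \<open>k \<ge> 1\<close>. At \<open>s = -m\<close> the coefficients with \<open>r > m + 1\<close> vanish, the terms with
  \<open>r \<le> m\<close> give the finite sum, and the product of zero and pole in the term \<open>r = m + 1\<close> gives the
  logarithmic term.
\<close>

section \<open>Simple poles and uniqueness of meromorphic functions\<close>

text \<open>The limit makes the singularity of \<open>f w * (w - z)\<close> removable. Filling it
  gives an analytic \<open>g\<close> with \<open>g z = c\<close>, and near \<open>z\<close> the
  function \<open>f\<close> is \<open>g / (w - z)\<close> with nonvanishing numerator.\<close>

lemma simple_pole_of_limit:
  assumes f: "f meromorphic_on {z}"
    and lim: "(\<lambda>w. f w * (w - z)) \<midarrow>z\<rightarrow> c" and c: "c \<noteq> 0"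
  shows "is_pole f z" "zorder f z = -1" "residue f z = c"
proof -
  define h where "h = (\<lambda>w. f w * (w - z))"
  have iso: "isolated_singularity_at f z"
    using f by (simp add: meromorphic_at_iff)
  have isoh: "isolated_singularity_at h z"
  proof -
    have "h meromorphic_on {z}"
      unfolding h_def using f by (intro meromorphic_intros)
    thus ?thesis by (simp add: meromorphic_at_iff)
  qed
  have lim': "h \<midarrow>z\<rightarrow> c" using lim by (simp add: h_def)
  define g where "g = remove_sings h"
  have gz: "g z = c" unfolding g_def using lim' by (rule remove_sings_eqI)
  have "g analytic_on {z}" unfolding g_def using isoh lim' by (rule remove_sings_analytic_at)
  then obtain S where S: "open S" "z \<in> S" "g holomorphic_on S"
    by (auto simp: analytic_at)
  have "eventually (\<lambda>w. g w = h w) (at z)"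
    unfolding g_def by (rule eventually_remove_sings_eq_at[OF isoh])
  moreover have "eventually (\<lambda>w. w \<noteq> z) (at z)" by (simp add: eventually_at_filter)
  ultimately have ev: "eventually (\<lambda>w. f w = g w / (w - z) ^ 1) (at z)"
    by eventually_elim (simp add: h_def field_simps)
  have "is_pole (\<lambda>w. g w / (w - z) ^ 1) z"
    by (rule is_pole_basic[OF S(3,1,2)]) (use gz c in auto)
  thus pole: "is_pole f z" using is_pole_cong[OF ev refl] by simp
  have "zorder (\<lambda>w. g w / (w - z) ^ 1) z = - int 1"
    by (rule zorder_nonzero_div_power[OF S]) (use gz c in auto)
  thus zo: "zorder f z = -1" using zorder_cong[OF ev refl] by simp
  show "residue f z = c"
    by (rule residue_simple_pole_limit[OF iso pole zo, of "\<lambda>x. x" c "at z"])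
       (use lim in \<open>auto simp: filterlim_at eventually_at_filter\<close>)
qed

text \<open>The identity theorem gives agreement on punctured neighbourhoods; the normalisation of
  values, \<open>0\<close> at poles and the limit elsewhere, extends it to every point.\<close>

lemma nicely_meromorphic_identity:
  assumes f: "f nicely_meromorphic_on UNIV" and g: "g nicely_meromorphic_on UNIV"
    and U: "open U" "U \<noteq> {}" and eq: "\<And>z. z \<in> U \<Longrightarrow> f z = g z"
  shows "f = g"
proof -
  have mf: "f meromorphic_on UNIV" and mg: "g meromorphic_on UNIV"
    using f g by (auto simp: nicely_meromorphic_on_def)
  \<comment> \<open>The plain difference need not be nicely meromorphic, for instance where two
    poles cancel, so its singularities are removed first.\<close>
  define d where "d = remove_sings (\<lambda>z. f z - g z)"
  have md: "(\<lambda>z. f z - g z) meromorphic_on UNIV"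
    by (intro meromorphic_intros mf mg)
  have d: "d nicely_meromorphic_on UNIV"
    unfolding d_def by (rule remove_sings_nicely_meromorphic[OF md])
  have iso: "isolated_singularity_at (\<lambda>z. f z - g z) z" for z
    using md by (meson UNIV_I meromorphic_on_isolated_singularity meromorphic_on_meromorphic_at)
  have evd: "eventually (\<lambda>w. d w = f w - g w) (at z)" for z
    unfolding d_def by (rule eventually_remove_sings_eq_at[OF iso])
  obtain z0 where z0: "z0 \<in> U" using U by auto
  have "eventually (\<lambda>w. w \<in> U) (at z0)"
    by (rule eventually_at_in_open'[OF U(1) z0])
  with evd[of z0] have "eventually (\<lambda>w. d w = 0) (at z0)"
    by eventually_elim (simp add: eq)
  hence "frequently (\<lambda>w. d w = 0) (at z0)"
    by (intro eventually_frequently) auto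
  from frequently_eq_meromorphic_imp_constant[OF this d]
  have d0: "d w = 0" for w by auto
  have ev: "eventually (\<lambda>w. f w = g w) (at z)" for z
    using evd[of z] by eventually_elim (simp add: d0)
  have "f z = g z" for z
  proof -
    have "is_pole f z \<longleftrightarrow> is_pole g z" by (rule is_pole_cong[OF ev refl])
    moreover have "is_pole f z \<and> f z = 0 \<or> f \<midarrow>z\<rightarrow> f z" "is_pole g z \<and> g z = 0 \<or> g \<midarrow>z\<rightarrow> g z"
      using f g by (auto simp: nicely_meromorphic_on_def)
    moreover have "f \<midarrow>z\<rightarrow> g z \<longleftrightarrow> g \<midarrow>z\<rightarrow> g z" by (rule filterlim_cong[OF refl refl ev])
    moreover have False if "is_pole h z" "h \<midarrow>z\<rightarrow> h z" for h :: "complex \<Rightarrow> complex"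
      using that by (auto simp: is_pole_def dest: not_tendsto_and_filterlim_at_infinity[OF at_neq_bot])
    ultimately show ?thesis by (metis LIM_unique)
  qed
  thus ?thesis by auto
qed

section \<open>Pochhammer bounds and the binomial series\<close>

text \<open>Triangle inequality in each factor. The bound is again a Pochhammer symbol, so a real
  binomial series can serve as majorant.\<close>

lemma norm_pochhammer_le:
  fixes s :: complex
  assumes "norm s \<le> M"
  shows "norm (pochhammer s n) \<le> pochhammer M n"
proof (induction n)
  case (Suc n)
  have "norm (s + of_nat n) \<le> M + real n"
    using norm_triangle_ineq[of s "of_nat n"] assms by simp
  thus ?case using Suc
    by (auto simp: pochhammer_Suc norm_mult intro!: mult_mono pochhammer_nonneg order_trans[OF norm_ge_zero])
qed auto

text \<open>The sign of \<open>- s gchoose n\<close>, written with a Pochhammer symbol, cancels that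
  of \<open>(- x) ^ n\<close>.\<close>

lemma negative_binomial_series:
  fixes s x :: "'a :: {real_normed_field, banach}"
  assumes "((\<lambda>n. (- s gchoose n) * (- x) ^ n) sums S)"
  shows "((\<lambda>n. pochhammer s n / fact n * x ^ n) sums S)"
proof -
  have "(- s gchoose n) * (- x) ^ n = pochhammer s n / fact n * x ^ n" for n
    by (simp add: gbinomial_pochhammer power_minus[of x])
  thus ?thesis using assms by simp
qed

lemma negative_binomial_real:
  fixes x M :: real
  assumes "\<bar>x\<bar> < 1"
  shows "(\<lambda>n. pochhammer M n / fact n * x ^ n) sums (1 - x) powr (- M)"
  by (rule negative_binomial_series) (use gen_binomial_real[of "-x" "-M"] assms in simp)

lemma negative_binomial_complex:
  fixes x s :: complex
  assumes "norm x < 1"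
  shows "(\<lambda>n. pochhammer s n / fact n * x ^ n) sums (1 - x) powr (- s)"
  by (rule negative_binomial_series) (use gen_binomial_complex[of "-x" "-s"] assms in simp)

section \<open>The terms of the formula and their singularities\<close>

context
  fixes q :: real
  assumes q: "0 < q" "q < 1"
begin

text \<open>For \<open>Re u > 0\<close> this is the sum of the geometric series of
  \<open>(of_real q powr u) ^ n\<close> over \<open>n \<ge> 1\<close>.\<close>

definition lambert :: "complex \<Rightarrow> complex" where
  "lambert u = of_real q powr u / (1 - of_real q powr u)"

definition zeta_summand :: "nat \<Rightarrow> complex \<Rightarrow> complex" where
  "zeta_summand r s = pochhammer s r / fact r * lambert (s + of_nat r - 1)"

definition zeta_tail :: "nat \<Rightarrow> complex \<Rightarrow> complex" where
  "zeta_tail N s = (\<Sum>r. zeta_summand (r + N) s)"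

text \<open>
  As \<open>x / 0 = 0\<close>, at a point where some \<open>lambert (s + r - 1)\<close> is singular this sum silently omits
  that term; only limits of \<open>zeta_formula\<close> are meaningful there.
\<close>
definition zeta_formula :: "complex \<Rightarrow> complex" where
  "zeta_formula s = of_real (1 - q) powr s * (\<Sum>r. zeta_summand r s)"

lemma ln_q: "ln q < 0" "ln q \<noteq> 0" using q by auto

lemma norm_q_powr: "norm (of_real q powr u :: complex) = q powr Re u"
  using q by (simp add: norm_powr_real_powr)

lemma q_powr_lt_1_iff: "q powr x < 1 \<longleftrightarrow> x > 0"
  using q ln_q by (auto simp: powr_def mult_less_0_iff)

text \<open>Compare moduli. This confines the singularities of \<open>zeta_summand r\<close> to the
  line \<open>Re s = 1 - r\<close>.\<close>

lemma q_powr_eq_1_imp_Re: "of_real q powr u = (1::complex) \<Longrightarrow> Re u = 0"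
  using norm_q_powr[of u] q by (auto simp: powr_def)

lemma q_powr_eq_1_iff:
  "of_real q powr u = (1::complex) \<longleftrightarrow> (\<exists>n::int. u = 2 * of_real pi * \<i> * of_int n / of_real (ln q))"
proof -
  have "of_real q powr u = exp (u * of_real (ln q))"
    using q by (simp add: powr_def Ln_of_real)
  hence "of_real q powr u = (1::complex) \<longleftrightarrow> (\<exists>n::int. u * of_real (ln q) = 2 * of_real pi * \<i> * of_int n)"
    using exp_eq[of "u * of_real (ln q)" 0] by (simp add: mult_ac)
  also have "\<dots> \<longleftrightarrow> (\<exists>n::int. u = 2 * of_real pi * \<i> * of_int n / of_real (ln q))"
    using ln_q by (auto simp: field_simps)
  finally show ?thesis .
qed

lemma analytic_summand:
  assumes "of_real q powr (z + of_nat r - 1) \<noteq> (1::complex)"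
  shows "zeta_summand r analytic_on {z}"
  unfolding zeta_summand_def lambert_def pochhammer_prod
  using assms q by (intro analytic_intros) auto

lemma meromorphic_summand: "zeta_summand r meromorphic_on A"
proof -
  have "(\<lambda>s. of_real q powr (s + of_nat r - 1) :: complex) analytic_on A"
    using q by (intro analytic_intros) auto
  thus ?thesis
    unfolding zeta_summand_def lambert_def pochhammer_prod
    by (intro meromorphic_intros analytic_on_imp_meromorphic_on[of _ A])
qed

lemma analytic_prefactor: "(\<lambda>s. of_real (1 - q) powr s :: complex) analytic_on A"
  using q by (intro analytic_intros) (auto simp: complex_nonpos_Reals_iff)

section \<open>Convergence and holomorphy of the tails\<close>

lemma norm_lambert_le:
  assumes "c > 0" "Re u \<ge> c"
  shows "norm (lambert u) \<le> q powr Re u / (1 - q powr c)"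
proof -
  have "q powr Re u \<le> q powr c" using q assms by (intro powr_mono') auto
  moreover have "q powr c < 1" using assms by (simp add: q_powr_lt_1_iff)
  moreover have "1 - q powr Re u \<le> norm (1 - of_real q powr u :: complex)"
    using norm_triangle_ineq2[of 1 "of_real q powr u :: complex"] by (simp add: norm_q_powr)
  ultimately show ?thesis
    unfolding lambert_def norm_divide norm_q_powr by (intro divide_left_mono frac_le) auto
qed

text \<open>Every argument of \<open>lambert\<close> here has real part at least
  \<open>c + real N - 1 > 0\<close>, which keeps the denominator away from \<open>0\<close>. The
  bound is free of \<open>s\<close>, and in \<open>r\<close> it is a constant times a term of the
  binomial series of \<open>(1 - q) powr (- M)\<close>.\<close>

lemma tail_bound:
  assumes s: "norm s \<le> M" "Re s \<ge> c" and c: "c + real N > 1"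
  shows "norm (zeta_summand (r + N) s)
           \<le> pochhammer M (r + N) / fact (r + N) * q ^ (r + N) * (q powr (c - 1) / (1 - q powr (c + real N - 1)))"
proof -
  let ?u = "s + of_nat (r + N) - 1"
  have "norm (lambert ?u) \<le> q powr Re ?u / (1 - q powr (c + real N - 1))"
    by (rule norm_lambert_le) (use s c in auto)
  also have "q powr Re ?u \<le> q powr (real (r + N) + (c - 1))"
    using q s by (intro powr_mono') auto
  also have "\<dots> = q ^ (r + N) * q powr (c - 1)"
    using q by (simp only: powr_add powr_realpow)
  finally have 1: "norm (lambert ?u) \<le> q ^ (r + N) * q powr (c - 1) / (1 - q powr (c + real N - 1))"
    using c by (simp add: divide_right_mono q_powr_lt_1_iff less_imp_le)
  have "norm (zeta_summand (r + N) s) = norm (pochhammer s (r + N)) / fact (r + N) * norm (lambert ?u)"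
    by (simp add: zeta_summand_def norm_mult norm_divide del: of_nat_add)
  also have "\<dots> \<le> pochhammer M (r + N) / fact (r + N)
                    * (q ^ (r + N) * q powr (c - 1) / (1 - q powr (c + real N - 1)))"
    by (intro mult_mono divide_right_mono norm_pochhammer_le s 1 divide_nonneg_nonneg
        order_trans[OF norm_ge_zero norm_pochhammer_le[OF s(1)]]) auto
  finally show ?thesis by simp
qed

lemma summable_majorant:
  "summable (\<lambda>r. pochhammer M (r + N) / fact (r + N) * q ^ (r + N) * C)"
proof -
  have "summable (\<lambda>r. pochhammer M r / fact r * q ^ r)"
    using negative_binomial_real[of q M] q by (auto simp: sums_iff)
  hence "summable (\<lambda>r. pochhammer M (r + N) / fact (r + N) * q ^ (r + N))"
    by (rule summable_ignore_initial_segment)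
  thus ?thesis by (rule summable_mult2)
qed

text \<open>On this half-plane the arguments of all terms from index \<open>N\<close> on have
  positive real part, so each term is analytic; the M-test on closed discs gives locally uniform
  convergence.\<close>

lemma holomorphic_tail: "zeta_tail N holomorphic_on {s. Re s > 1 - real N}"
  unfolding zeta_tail_def
proof (rule holomorphic_uniform_sequence)
  show "open {s. Re s > 1 - real N}" by (rule open_halfspace_Re_gt)
  have "zeta_summand (r + N) analytic_on {s. Re s > 1 - real N}" for r
    unfolding analytic_on_analytic_at[of _ "{s. Re s > 1 - real N}"]
    by (auto intro!: analytic_summand dest: q_powr_eq_1_imp_Re)
  thus "(\<lambda>s. \<Sum>r<n. zeta_summand (r + N) s) holomorphic_on {s. Re s > 1 - real N}" for n
    by (intro holomorphic_intros analytic_imp_holomorphic)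
  fix x assume x: "x \<in> {s. Re s > 1 - real N}"
  \<comment> \<open>Half the distance from \<open>x\<close> to the boundary line; \<open>c\<close>
    is the least real part on the disc and still lies inside the half-plane.\<close>
  define d where "d = (Re x - (1 - real N)) / 2"
  define c where "c = Re x - d"
  have d: "d > 0" "c + real N > 1" using x by (auto simp: d_def c_def field_simps)
  have *: "norm s \<le> norm x + d" "Re s \<ge> c" if "s \<in> cball x d" for s
  proof -
    have "norm (x - s) \<le> d" using that by (simp add: dist_norm)
    thus "norm s \<le> norm x + d" using norm_triangle_ineq2[of s x] by (simp add: norm_minus_commute)
    show "Re s \<ge> c" using abs_Re_le_cmod[of "x - s"] \<open>norm (x - s) \<le> d\<close> by (simp add: c_def)
  qed
  have "cball x d \<subseteq> {s. Re s > 1 - real N}" using * d by fastforce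
  moreover have "uniform_limit (cball x d) (\<lambda>n s. \<Sum>r<n. zeta_summand (r + N) s)
          (\<lambda>s. \<Sum>r. zeta_summand (r + N) s) sequentially"
    by (rule Weierstrass_m_test[OF tail_bound summable_majorant]) (use * d in auto)
  ultimately show "\<exists>d>0. cball x d \<subseteq> {s. Re s > 1 - real N} \<and>
      uniform_limit (cball x d) (\<lambda>n s. \<Sum>r<n. zeta_summand (r + N) s)
        (\<lambda>s. \<Sum>r. zeta_summand (r + N) s) sequentially"
    using d by blast
qed

lemma analytic_tail: "Re z > 1 - real N \<Longrightarrow> zeta_tail N analytic_on {z}"
  using holomorphic_tail[of N] open_halfspace_Re_gt[of "1 - real N"]
  unfolding analytic_at by blast

lemma summable_summand: "summable (\<lambda>r. zeta_summand r s)"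
proof -
  obtain N :: nat where N: "Re s + real N > 1"
    by (metis add.commute diff_less_eq reals_Archimedean2)
  have "summable (\<lambda>r. zeta_summand (r + N) s)"
    by (rule summable_comparison_test'[OF summable_majorant tail_bound[OF order_refl order_refl N]])
  thus ?thesis by (rule iffD1[OF summable_iff_shift])
qed

section \<open>Meromorphy of the formula and its regular part\<close>

lemma zeta_formula_split:
  "zeta_formula s = of_real (1 - q) powr s * ((\<Sum>r<N. zeta_summand r s) + zeta_tail N s)"
  unfolding zeta_formula_def zeta_tail_def
  using suminf_split_initial_segment[OF summable_summand, of s N] by simp

text \<open>Near a given \<open>z\<close>, cut so late that \<open>z\<close> lies in the half-plane
  of the tail: finitely many meromorphic terms and an analytic remainder are left.\<close>

lemma meromorphic_zeta_formula: "zeta_formula meromorphic_on UNIV"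
  unfolding meromorphic_on_meromorphic_at[of _ UNIV]
proof
  fix z :: complex
  obtain N :: nat where N: "Re z > 1 - real N"
    by (metis add.commute diff_less_eq reals_Archimedean2)
  show "zeta_formula meromorphic_on {z}"
    unfolding zeta_formula_split[of _ N, abs_def]
    by (intro meromorphic_intros analytic_on_imp_meromorphic_on[OF analytic_prefactor]
          meromorphic_summand analytic_on_imp_meromorphic_on[OF analytic_tail[OF N]])
qed

lemma analytic_zeta_formula:
  assumes "\<And>r. of_real q powr (z + of_nat r - 1) \<noteq> (1::complex)"
  shows "zeta_formula analytic_on {z}"
proof -
  obtain N :: nat where N: "Re z > 1 - real N"
    by (metis add.commute diff_less_eq reals_Archimedean2)
  show ?thesis
    unfolding zeta_formula_split[of _ N, abs_def]
    by (intro analytic_intros analytic_prefactor analytic_summand analytic_tail N assms)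
qed

definition zeta_regular_part :: "nat \<Rightarrow> complex \<Rightarrow> complex" where
  "zeta_regular_part k s =
     of_real (1 - q) powr s * ((\<Sum>r<k. zeta_summand r s) + zeta_tail (Suc k) s)"

lemma zeta_formula_regular_part:
  "zeta_formula s = zeta_regular_part k s + of_real (1 - q) powr s * zeta_summand k s"
  unfolding zeta_formula_split[of s "Suc k"] zeta_regular_part_def by (simp add: algebra_simps)

text \<open>On this line the terms with \<open>r < k\<close> have argument of real part
  \<open>r - k < 0\<close>, hence no singularity, and the tail from \<open>Suc k\<close> is
  holomorphic for \<open>Re s > - real k\<close>.\<close>

lemma analytic_zeta_regular_part:
  assumes "Re z = 1 - real k"
  shows "zeta_regular_part k analytic_on {z}"
  unfolding zeta_regular_part_def
  using assms by (intro analytic_intros analytic_prefactor analytic_summand analytic_tail)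
     (auto dest!: q_powr_eq_1_imp_Re)

section \<open>Behaviour at a singular point\<close>

text \<open>Since \<open>of_real q powr z = 1\<close>, the difference quotient of
  \<open>of_real q powr u\<close> at \<open>z\<close> tends to \<open>ln q\<close>; the expression
  is minus the power divided by that quotient.\<close>

lemma lambert_limit:
  assumes "of_real q powr z = (1::complex)"
  shows "(\<lambda>u. lambert u * (u - z)) \<midarrow>z\<rightarrow> of_real (- 1 / ln q)"
proof -
  have "((\<lambda>u. of_real q powr u :: complex) has_field_derivative of_real q powr z * Ln (of_real q)) (at z)"
    using q by (auto intro!: derivative_eq_intros)
  hence "(\<lambda>u. (of_real q powr u - of_real q powr z :: complex) / (u - z)) \<midarrow>z\<rightarrow> of_real q powr z * Ln (of_real q)"
    by (simp add: has_field_derivative_iff)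
  hence D: "(\<lambda>u. (of_real q powr u - 1 :: complex) / (u - z)) \<midarrow>z\<rightarrow> of_real (ln q)"
    using q by (simp add: assms Ln_of_real)
  have C: "(\<lambda>u. of_real q powr u :: complex) \<midarrow>z\<rightarrow> 1"
  proof -
    have "(\<lambda>u. of_real q powr u :: complex) analytic_on {z}" using q by (intro analytic_intros) auto
    hence "(\<lambda>u. of_real q powr u :: complex) \<midarrow>z\<rightarrow> of_real q powr z"
      by (intro isContD analytic_at_imp_isCont)
    thus ?thesis by (simp add: assms)
  qed
  have "(\<lambda>u. - (of_real q powr u) / ((of_real q powr u - 1 :: complex) / (u - z))) \<midarrow>z\<rightarrow> (- 1 / of_real (ln q))"
    by (intro tendsto_divide tendsto_minus C D) (use ln_q in auto)
  \<comment> \<open>In the cases \<open>x = 1\<close> and \<open>y = 0\<close> both sides are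
    \<open>0\<close>, division by zero being \<open>0\<close>, so the two functions agree
    everywhere.\<close>
  moreover have "- x / ((x - 1) / y) = x / (1 - x) * y" for x y :: complex
    by (cases "x = 1"; cases "y = 0") (auto simp: field_simps)
  ultimately show ?thesis by (simp add: lambert_def)
qed

lemma shifted_lambert_limit:
  assumes "of_real q powr (z + of_nat k - 1) = (1::complex)"
  shows "(\<lambda>s. lambert (s + of_nat k - 1) * (s - z)) \<midarrow>z\<rightarrow> of_real (- 1 / ln q)"
proof -
  have "(\<lambda>s. lambert (s + of_nat k - 1) * ((s + of_nat k - 1) - (z + of_nat k - 1))) \<midarrow>z\<rightarrow> of_real (- 1 / ln q)"
    by (rule LIM_compose_eventually[OF _ lambert_limit[OF assms]])
       (auto intro!: tendsto_intros simp: eventually_at_filter)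
  thus ?thesis by simp
qed

text \<open>The factor \<open>s - z\<close> annihilates the regular part, leaving only the Lambert
  pole of term \<open>k\<close>.\<close>

lemma zeta_formula_limit:
  assumes z: "of_real q powr (z + of_nat k - 1) = (1::complex)"
  shows "(\<lambda>s. zeta_formula s * (s - z)) \<midarrow>z\<rightarrow>
           of_real (1 - q) powr z * (pochhammer z k / fact k) * of_real (- 1 / ln q)"
proof -
  have Re: "Re z = 1 - real k" using q_powr_eq_1_imp_Re[OF z] by simp
  note L = shifted_lambert_limit[OF z]
  have R: "zeta_regular_part k \<midarrow>z\<rightarrow> zeta_regular_part k z"
    by (intro isContD analytic_at_imp_isCont analytic_zeta_regular_part Re)
  have P: "(\<lambda>s. of_real (1 - q) powr s :: complex) \<midarrow>z\<rightarrow> of_real (1 - q) powr z"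
    by (intro isContD analytic_at_imp_isCont analytic_prefactor)
  have "(\<lambda>s. zeta_regular_part k s * (s - z)
            + of_real (1 - q) powr s * (pochhammer s k / fact k) * (lambert (s + of_nat k - 1) * (s - z)))
     \<midarrow>z\<rightarrow> (zeta_regular_part k z * (z - z) + of_real (1 - q) powr z * (pochhammer z k / fact k) * of_real (- 1 / ln q))"
    unfolding pochhammer_prod by (intro tendsto_intros R P L) auto
  moreover have "zeta_formula s * (s - z) = zeta_regular_part k s * (s - z)
            + of_real (1 - q) powr s * (pochhammer s k / fact k) * (lambert (s + of_nat k - 1) * (s - z))" for s
    by (simp add: zeta_formula_regular_part[of _ k] zeta_summand_def distrib_right)
  ultimately show ?thesis by simp
qed

section \<open>Agreement with the series for \<open>Re s > 1\<close>\<close>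

lemma q_zeta_term_eq:
  assumes "n \<ge> 1"
  shows "q_zeta_term q s n =
    of_real (1 - q) powr s * (of_real q powr (of_nat n * (s - 1)) * (1 - of_real (q ^ n)) powr (- s))"
proof -
  have pos: "0 < 1 - q ^ n" "0 < 1 - q"
    using q assms power_Suc_less_one[of q "n - 1"] by (auto simp: power_less_one_iff)
  have exp: "of_real a powr s = exp (s * of_real (ln a))" if "a > 0" for a and s :: complex
    using that by (simp add: powr_def Ln_of_real)
  have 1: "1 - of_real (q ^ n) = complex_of_real (1 - q ^ n)" by simp
  show ?thesis
    unfolding q_zeta_term_def q_bracket_def 1
    by (subst (2 3 4) exp) (use pos in \<open>auto simp: ln_div exp_diff exp_minus field_simps exp_add[symmetric]\<close>)
qed

text \<open>A double series \<open>\<phi>\<close> is summed in both orders: over \<open>r\<close>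
  first by the binomial series, over \<open>n\<close> first by the geometric series. Absolute
  convergence makes both results equal \<open>S\<close>.\<close>

lemma zeta_formula_has_sum:
  assumes s: "Re s > 1"
  shows "(q_zeta_term q s has_sum zeta_formula s) {1..}"
proof -
  define c where "c = (\<lambda>r. pochhammer s r / fact r)"
  define \<phi> where "\<phi> = (\<lambda>(n::nat, r::nat). c r * (of_real q powr (s + of_nat r - 1)) ^ n)"
  define m where "m = (\<lambda>r. pochhammer (norm s) r / fact r * q ^ r)"
  define x where "x = q powr (Re s - 1)"
  have x: "0 \<le> x" "x < 1" using s by (auto simp: x_def q_powr_lt_1_iff)
  have m0: "m r \<ge> 0" for r
    unfolding m_def using q order_trans[OF norm_ge_zero norm_pochhammer_le[of s "norm s" r]] by simp
  have m: "(m has_sum (1 - q) powr (- norm s)) UNIV"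
    by (rule sums_nonneg_imp_has_sum[OF _ m0])
       (use negative_binomial_real[of q "norm s"] q in \<open>simp add: m_def\<close>)
  have bound: "norm (\<phi> (n, r)) \<le> x ^ n * m r" if "n \<ge> 1" for n r
  proof -
    have "norm (\<phi> (n, r)) = norm (pochhammer s r) / fact r * (q powr (Re s - 1 + real r)) ^ n"
      by (simp add: \<phi>_def c_def norm_mult norm_divide norm_power norm_q_powr algebra_simps)
    also have "(q powr (Re s - 1 + real r)) ^ n = x ^ n * (q ^ r) ^ n"
      using q by (simp add: x_def powr_add powr_realpow power_mult_distrib)
    \<comment> \<open>As \<open>n \<ge> 1\<close>, \<open>(q ^ r) ^ n\<close> is at most
      \<open>q ^ r\<close>; this decouples the indices and yields a product majorant.\<close>
    also have "norm (pochhammer s r) / fact r * (x ^ n * (q ^ r) ^ n)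
             \<le> pochhammer (norm s) r / fact r * (x ^ n * (q ^ r) ^ 1)"
      using that q x order_trans[OF norm_ge_zero norm_pochhammer_le[of s "norm s" r]]
      by (intro mult_mono divide_right_mono norm_pochhammer_le power_decreasing mult_nonneg_nonneg)
         (auto simp: power_le_one)
    finally show ?thesis by (simp add: m_def mult_ac)
  qed
  have "(\<lambda>(n, r). x ^ n * m r) summable_on ({1..} \<times> UNIV)"
  proof (rule summable_on_SigmaI)
    show "((\<lambda>r. case (n, r) of (n, r) \<Rightarrow> x ^ n * m r) has_sum x ^ n * (1 - q) powr (- norm s)) UNIV" for n
      using has_sum_cmult_right[OF m] by simp
    have "(\<lambda>n. x ^ n) summable_on {1..}"
      using has_sum_geometric_from_1[of x] x by (auto simp: summable_on_def)
    thus "(\<lambda>n. x ^ n * (1 - q) powr (- norm s)) summable_on {1..}"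
      by (rule summable_on_cmult_left)
  qed (use m0 x in auto)
  hence "(\<lambda>p. norm (\<phi> p)) summable_on ({1..} \<times> UNIV)"
    by (rule Infinite_Sum.abs_summable_on_comparison_test') (use bound in auto)
  hence "\<phi> summable_on ({1..} \<times> UNIV)"
    by (rule abs_summable_summable)
  then obtain S where S: "(\<phi> has_sum S) ({1..} \<times> UNIV)" by (auto simp: summable_on_def)

  have rows: "((\<lambda>r. \<phi> (n, r)) has_sum
      of_real q powr (of_nat n * (s - 1)) * (1 - of_real (q ^ n)) powr (- s)) UNIV" if n: "n \<in> {1..}" for n
  proof -
    have eq: "\<phi> (n, r) = of_real q powr (of_nat n * (s - 1)) * (c r * of_real (q ^ n) ^ r)" for r
    proof -
      have "(of_real q powr (s + of_nat r - 1) :: complex) ^ n = of_real q powr (of_nat n * (s - 1) + of_nat (n * r))"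
        using q by (simp add: powr_def flip: exp_of_nat_mult) (simp add: algebra_simps)
      also have "\<dots> = of_real q powr (of_nat n * (s - 1)) * of_real q powr (of_nat (n * r))"
        by (rule powr_add)
      also have "of_real q powr (of_nat (n * r)) = (of_real (q ^ n) ^ r :: complex)"
        using q by (subst powr_nat') (auto simp: power_mult)
      finally show ?thesis by (simp add: \<phi>_def mult_ac)
    qed
    have "norm (of_real (q ^ n) :: complex) < 1"
      using q n by (simp add: norm_power power_less_one_iff)
    from negative_binomial_complex[OF this, of s]
    have "(\<lambda>r. \<phi> (n, r)) sums
       (of_real q powr (of_nat n * (s - 1)) * (1 - of_real (q ^ n)) powr (- s))"
      unfolding eq c_def by (rule sums_mult)
    moreover have "summable (\<lambda>r. norm (\<phi> (n, r)))"
    proof (rule summable_comparison_test')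
      show "summable (\<lambda>r. x ^ n * m r)"
        using has_sum_imp_sums[OF m] by (intro summable_mult) (auto simp: sums_iff)
    qed (use bound n in auto)
    ultimately show ?thesis by (rule norm_summable_imp_has_sum[rotated])
  qed
  have columns: "((\<lambda>n. \<phi> (n, r)) has_sum zeta_summand r s) {1..}" for r
  proof -
    have "norm (of_real q powr (s + of_nat r - 1) :: complex) < 1"
      using s by (simp add: norm_q_powr q_powr_lt_1_iff)
    from has_sum_cmult_right[OF has_sum_geometric_from_1[OF this], of "c r"]
    show ?thesis by (simp add: \<phi>_def zeta_summand_def c_def lambert_def)
  qed
  have "((\<lambda>(r, n). \<phi> (n, r)) has_sum S) (UNIV \<times> {1..})"
    using S by (subst (asm) has_sum_swap)
  hence "((\<lambda>r. zeta_summand r s) has_sum S) UNIV"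
    by (rule has_sum_SigmaD) (use columns in simp)
  hence "S = (\<Sum>r. zeta_summand r s)"
    by (metis has_sum_imp_sums sums_unique)
  moreover have "((\<lambda>n. of_real q powr (of_nat n * (s - 1)) * (1 - of_real (q ^ n)) powr (- s)) has_sum S) {1..}"
    using S rows by (rule has_sum_SigmaD)
  ultimately have "((\<lambda>n. of_real (1 - q) powr s * (of_real q powr (of_nat n * (s - 1)) * (1 - of_real (q ^ n)) powr (- s)))
      has_sum zeta_formula s) {1..}"
    unfolding zeta_formula_def by (simp only: has_sum_cmult_right)
  also have "?this \<longleftrightarrow> ?thesis"
    by (intro has_sum_cong) (simp only: q_zeta_term_eq atLeast_iff)
  finally show ?thesis .
qed

section \<open>Identification of \<open>q_zeta\<close> and its simple poles\<close>

lemma isolated_singularity_zeta_formula: "isolated_singularity_at zeta_formula z"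
  using meromorphic_on_subset[OF meromorphic_zeta_formula, of "{z}"] by (simp add: meromorphic_at_iff)

text \<open>\<open>remove_sings\<close> produces the required normalisation and changes nothing for
  \<open>Re s > 1\<close>, where the formula is analytic. Uniqueness is the identity theorem on that
  half-plane.\<close>

lemma q_zeta_eq: "q_zeta q = remove_sings zeta_formula"
  unfolding q_zeta_def
proof (rule the_equality)
  let ?f = "remove_sings zeta_formula"
  have nice: "?f nicely_meromorphic_on UNIV"
    by (rule remove_sings_nicely_meromorphic[OF meromorphic_zeta_formula])
  have "?f s = zeta_formula s" if "Re s > 1" for s
    using that by (intro remove_sings_at_analytic analytic_zeta_formula) (auto dest: q_powr_eq_1_imp_Re)
  hence sum: "(q_zeta_term q s has_sum ?f s) {1..}" if "Re s > 1" for s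
    using zeta_formula_has_sum that by simp
  show "?f nicely_meromorphic_on UNIV \<and> (\<forall>s. Re s > 1 \<longrightarrow> (q_zeta_term q s has_sum ?f s) {1..})"
    using nice sum by blast
  fix f assume f: "f nicely_meromorphic_on UNIV \<and> (\<forall>s. Re s > 1 \<longrightarrow> (q_zeta_term q s has_sum f s) {1..})"
  show "f = ?f"
  proof (rule nicely_meromorphic_identity)
    show "open {s. Re s > 1}" by (rule open_halfspace_Re_gt)
    show "{s. Re s > 1} \<noteq> {}" by (auto intro: exI[of _ 2])
    show "f s = ?f s" if "s \<in> {s. Re s > 1}" for s
      using f sum that by (auto intro: has_sum_unique)
  qed (use f nice in auto)
qed

lemma simple_pole_q_zeta:
  assumes z: "of_real q powr (z + of_nat k - 1) = (1::complex)" and nz: "pochhammer z k \<noteq> 0"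
  shows "is_pole (q_zeta q) z" "zorder (q_zeta q) z = -1"
    "residue (q_zeta q) z = of_real (1 - q) powr z * (pochhammer z k / fact k) * of_real (- 1 / ln q)"
proof -
  have "zeta_formula meromorphic_on {z}"
    using meromorphic_zeta_formula by (rule meromorphic_on_subset) auto
  moreover have "of_real (1 - q) powr z * (pochhammer z k / fact k) * of_real (- 1 / ln q) \<noteq> 0"
    using q nz ln_q by simp
  ultimately show "is_pole (q_zeta q) z" "zorder (q_zeta q) z = -1"
    "residue (q_zeta q) z = of_real (1 - q) powr z * (pochhammer z k / fact k) * of_real (- 1 / ln q)"
    using simple_pole_of_limit[OF _ zeta_formula_limit[OF z]] isolated_singularity_zeta_formula[of z]
    by (auto simp: q_zeta_eq)
qed

section \<open>Values at the nonpositive integers\<close>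

lemma q_zeta_limit_neg_nat:
  "q_zeta q \<midarrow>- of_nat m\<rightarrow>
     of_real ((1 - q) powi (- int m) *
       ((\<Sum>r=0..m. (-1) ^ r * real (m choose r) * (1 / (q ^ (m + 1 - r) - 1)))
         + (-1) ^ (m + 1) / (real (m + 1) * ln q)))"
proof -
  define z :: complex where "z = - of_nat m"
  \<comment> \<open>The index of the term singular at \<open>z\<close>, since
    \<open>z + of_nat k - 1 = 0\<close>.\<close>
  define k where "k = Suc m"
  have z1: "of_real q powr (z + of_nat k - 1) = (1::complex)" using q by (simp add: z_def k_def)
  have poch: "pochhammer z r / fact r = of_real ((-1) ^ r * real (m choose r))" for r
  proof -
    have "of_nat (m choose r) = (-1) ^ r * pochhammer z r / fact r"
      by (simp add: binomial_gbinomial gbinomial_pochhammer z_def)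
    thus ?thesis by (simp flip: power_mult_distrib)
  qed
  \<comment> \<open>All indices here are at least \<open>m + 2\<close>, so the binomial coefficients
    vanish.\<close>
  have tail: "zeta_tail (Suc k) z = 0"
    unfolding zeta_tail_def zeta_summand_def poch by (simp add: k_def binomial_eq_0)
  have summand: "zeta_summand r z = of_real ((-1) ^ r * real (m choose r) * (1 / (q ^ (m + 1 - r) - 1)))"
    if "r \<le> m" for r
  proof -
    define j where "j = m + 1 - r"
    have "of_real q powr (z + of_nat r - 1) = inverse (of_real (q ^ j) :: complex)"
    proof -
      have "z + of_nat r - 1 = - of_nat j" using that by (simp add: z_def j_def of_nat_diff)
      thus ?thesis using q by (simp add: powr_minus powr_nat')
    qed
    moreover have "0 < q ^ j" "q ^ j < 1"
      using q that by (auto simp: j_def power_less_one_iff)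
    hence "inverse (of_real (q ^ j)) / (1 - inverse (of_real (q ^ j))) = (1 / (of_real (q ^ j) - 1) :: complex)"
      using q by (auto simp: divide_simps simp del: of_real_power)
    ultimately show ?thesis unfolding zeta_summand_def poch lambert_def j_def by simp
  qed
  have R: "zeta_regular_part k \<midarrow>z\<rightarrow> zeta_regular_part k z"
    by (intro isContD analytic_at_imp_isCont analytic_zeta_regular_part) (simp add: z_def k_def)
  have P: "(\<lambda>s. of_real (1 - q) powr s :: complex) \<midarrow>z\<rightarrow> of_real (1 - q) powr z"
    by (intro isContD analytic_at_imp_isCont analytic_prefactor)
  note L = shifted_lambert_limit[OF z1]
  have Q: "(\<lambda>s. pochhammer s m / fact k) \<midarrow>z\<rightarrow> pochhammer z m / fact k"
    unfolding pochhammer_prod by (intro tendsto_intros) auto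
  \<comment> \<open>The last factor of \<open>pochhammer s k\<close> is
    \<open>s + of_nat m = s - z\<close>; moving this zero to the Lambert factor cancels its
    pole.\<close>
  have "(\<lambda>s. zeta_regular_part k s + of_real (1 - q) powr s * (pochhammer s m / fact k * (lambert (s + of_nat k - 1) * (s - z))))
     \<midarrow>z\<rightarrow> (zeta_regular_part k z + of_real (1 - q) powr z * (pochhammer z m / fact k * of_real (- 1 / ln q)))"
    by (intro tendsto_intros R P Q L)
  moreover have "zeta_formula = (\<lambda>s. zeta_regular_part k s
       + of_real (1 - q) powr s * (pochhammer s m / fact k * (lambert (s + of_nat k - 1) * (s - z))))"
    unfolding zeta_formula_regular_part[of _ k, abs_def] zeta_summand_def
    by (simp add: k_def z_def pochhammer_Suc mult_ac)
  ultimately have "zeta_formula \<midarrow>z\<rightarrow>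
      zeta_regular_part k z + of_real (1 - q) powr z * (pochhammer z m / fact k * of_real (- 1 / ln q))"
    by (simp only:)
  also have "of_real (1 - q) powr z = (of_real ((1 - q) powi (- int m)) :: complex)"
    using q by (simp add: z_def powr_minus powr_nat' power_int_minus)
  also have "zeta_regular_part k z = of_real ((1 - q) powi (- int m)) *
      of_real (\<Sum>r=0..m. (-1) ^ r * real (m choose r) * (1 / (q ^ (m + 1 - r) - 1)))"
    unfolding zeta_regular_part_def tail \<open>of_real (1 - q) powr z = _\<close> add_0_right of_real_sum
    by (intro arg_cong2[where f = "(*)"] refl sum.cong summand) (auto simp: k_def)
  \<comment> \<open>\<open>fact k\<close> exceeds \<open>fact m\<close> by the factor
    \<open>m + 1\<close>, and the minus sign of the residue turns \<open>(-1) ^ m\<close> into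
    \<open>(-1) ^ (m + 1)\<close>.\<close>
  also have "pochhammer z m / fact k * of_real (- 1 / ln q)
      = (of_real ((-1) ^ (m + 1) / (real (m + 1) * ln q)) :: complex)"
  proof -
    have "pochhammer z m / fact k = (pochhammer z m / fact m) / of_nat (m + 1)"
      by (simp add: k_def field_simps)
    also have "\<dots> = of_real ((-1) ^ m / real (m + 1))" by (simp add: poch)
    finally have eq: "pochhammer z m / fact k = of_real ((-1) ^ m / real (m + 1))" .
    show ?thesis unfolding eq by simp
  qed
  finally show ?thesis
    unfolding q_zeta_eq tendsto_remove_sings_iff[OF isolated_singularity_zeta_formula]
    by (simp only: z_def distrib_left of_real_add of_real_mult)
qed

section \<open>The set of poles\<close>

text \<open>Without a singular term the formula is analytic at \<open>z\<close>. If the coefficient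
  of a singular term vanished, \<open>z\<close> would be a nonpositive integer, where the finite
  limit rules out a pole.\<close>

lemma is_pole_q_zeta_iff:
  "is_pole (q_zeta q) z \<longleftrightarrow>
     (\<exists>k. of_real q powr (z + of_nat k - 1) = (1::complex) \<and> pochhammer z k \<noteq> 0)"
proof
  assume pole: "is_pole (q_zeta q) z"
  have "\<exists>k. of_real q powr (z + of_nat k - 1) = (1::complex)"
  proof (rule ccontr)
    assume "\<not> ?thesis"
    hence "zeta_formula analytic_on {z}" by (intro analytic_zeta_formula) auto
    thus False using pole analytic_at_imp_no_pole isolated_singularity_zeta_formula[of z]
      by (auto simp: q_zeta_eq)
  qed
  then obtain k where k: "of_real q powr (z + of_nat k - 1) = (1::complex)" by blast
  have "pochhammer z k \<noteq> 0"
  proof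
    assume "pochhammer z k = 0"
    then obtain j where "z = - of_nat j" by (auto simp: pochhammer_eq_0_iff)
    thus False using pole q_zeta_limit_neg_nat[of j]
      by (auto simp: is_pole_def dest: not_tendsto_and_filterlim_at_infinity[OF at_neq_bot])
  qed
  thus "\<exists>k. of_real q powr (z + of_nat k - 1) = (1::complex) \<and> pochhammer z k \<noteq> 0" using k by blast
qed (use simple_pole_q_zeta in blast)

text \<open>\<open>k = 0\<close> gives the points with real part \<open>1\<close>, and
  \<open>k \<ge> 1\<close> those with \<open>a = 1 - k\<close>; there the nonvanishing coefficient
  excludes exactly \<open>b = 0\<close>.\<close>

lemma q_zeta_poles_iff:
  "z \<in> q_zeta_poles q \<longleftrightarrow>
     (\<exists>k. of_real q powr (z + of_nat k - 1) = (1::complex) \<and> pochhammer z k \<noteq> 0)"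
proof
  assume "z \<in> q_zeta_poles q"
  then consider b :: int where "z = 1 + 2 * of_real pi * \<i> * of_int b / of_real (ln q)"
    | a b :: int where "z = of_int a + 2 * of_real pi * \<i> * of_int b / of_real (ln q)" "a \<le> 0" "b \<noteq> 0"
    by (auto simp: q_zeta_poles_def)
  thus "\<exists>k. of_real q powr (z + of_nat k - 1) = (1::complex) \<and> pochhammer z k \<noteq> 0"
  proof cases
    case 1
    thus ?thesis by (intro exI[of _ 0]) (auto simp: q_powr_eq_1_iff)
  next
    case 2
    define k where "k = nat (1 - a)"
    have "of_nat k = (1 - of_int a :: complex)" using 2 by (simp add: k_def)
    hence "of_real q powr (z + of_nat k - 1) = (1::complex)"
      using 2 by (auto simp: q_powr_eq_1_iff)
    \<comment> \<open>The zeros of the Pochhammer symbol are real, so a nonzero imaginary part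
      suffices.\<close>
    moreover have "Im z = 2 * pi * of_int b / ln q" using 2 by simp
    hence "Im z \<noteq> 0" using 2 ln_q by simp
    hence "pochhammer z k \<noteq> 0" by (auto simp: pochhammer_eq_0_iff)
    ultimately show ?thesis by blast
  qed
next
  assume "\<exists>k. of_real q powr (z + of_nat k - 1) = (1::complex) \<and> pochhammer z k \<noteq> 0"
  then obtain k b where b: "z + of_nat k - 1 = 2 * of_real pi * \<i> * of_int b / of_real (ln q)"
    and nz: "pochhammer z k \<noteq> 0" by (auto simp: q_powr_eq_1_iff)
  have z: "z = of_int (1 - int k) + 2 * of_real pi * \<i> * of_int b / of_real (ln q)"
    using b by (simp add: algebra_simps)
  show "z \<in> q_zeta_poles q"
  proof (cases k)
    case 0
    thus ?thesis using z by (auto simp: q_zeta_poles_def)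
  next
    case (Suc j)
    have "b \<noteq> 0"
    proof
      assume "b = 0"
      hence "z = - of_nat j" using z Suc by simp
      thus False using nz Suc by (auto simp: pochhammer_eq_0_iff)
    qed
    thus ?thesis using z Suc unfolding q_zeta_poles_def by fastforce
  qed
qed

end

theorem proposition2:
  fixes q :: real
  assumes "0 < q" and "q < 1"
  shows "({s. is_pole (q_zeta q) s} = q_zeta_poles q \<and>
          (\<forall>s\<in>q_zeta_poles q. zorder (q_zeta q) s = -1) \<and>
          is_pole (q_zeta q) 1 \<and> zorder (q_zeta q) 1 = -1 \<and>
          residue (q_zeta q) 1 = of_real ((q - 1) / ln q)) \<and>
         (\<forall>m::nat. q_zeta q \<midarrow>- of_nat m\<rightarrow>
            of_real ((1 - q) powi (- int m) *
              ((\<Sum>r=0..m. (-1) ^ r * real (m choose r) * (1 / (q ^ (m + 1 - r) - 1)))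
               + (-1) ^ (m + 1) / (real (m + 1) * ln q))))"
proof -
  \<comment> \<open>At \<open>s = 1\<close> the singular term is that of index \<open>0\<close>,
    with coefficient \<open>1\<close>.\<close>
  have one: "of_real q powr (1 + of_nat 0 - 1) = (1::complex)" "pochhammer (1::complex) 0 \<noteq> 0"
    using assms by auto
  have "of_real (1 - q) powr 1 * (pochhammer 1 0 / fact 0) * of_real (- 1 / ln q)
      = (of_real ((q - 1) / ln q) :: complex)"
    using assms by (simp add: field_simps flip: of_real_diff)
  with simple_pole_q_zeta[OF assms one] have "is_pole (q_zeta q) 1" "zorder (q_zeta q) 1 = -1"
      "residue (q_zeta q) 1 = of_real ((q - 1) / ln q)"
    by simp_all
  moreover have "{s. is_pole (q_zeta q) s} = q_zeta_poles q"
    by (auto simp: is_pole_q_zeta_iff[OF assms] q_zeta_poles_iff[OF assms])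
  moreover have "\<forall>s\<in>q_zeta_poles q. zorder (q_zeta q) s = -1"
    using simple_pole_q_zeta(2)[OF assms] by (auto simp: q_zeta_poles_iff[OF assms])
  ultimately show ?thesis using q_zeta_limit_neg_nat[OF assms] by blast
qed

end
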